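(* Let $n\ge 2$ and let $Z$ be a holomorphic retract of $\Delta\times\mathbb{B}^{n-1}$. Assume that $Z$ contains the origin, $Z\ne\{0\}$ and $Z\neq\Delta\times\mathbb{B}^{n-1}$. Then $Z$ is given as one of the following: (i) $Z=\{(w,c_1w,\dots,c_{n-1}w):w\in\Delta\}$, where $(c_1,c_2,\dots,c_{n-1})\in\partial\mathbb{B}^{n-1}$; (ii) $Z$ is the graph of a $\mathbb{B}^{n-1}$-valued holomorphic mapping of $\Delta$; (iii) $Z$ is the graph of a $\Delta$-valued holomorphic function over a complex linear subspace of $\mathbb{B}^{n-1}$; (iv) $Z$ is the intersection of a complex linear subspace of $\mathbb{C}^n$ with $\Delta\times\mathbb{B}^{n-1}$, of complex dimension at least two.
   Context: $\Delta\subset\mathbb{C}$ is the unit disc and $\mathbb{B}^{n-1}\subset\mathbb{C}^{n-1}$ the unit ball. A holomorphic retract of a complex manifold $X$ is the image of a holomorphic map $r:X\to X$ with $r\circ r=r$. A complex linear subspace of a domain $D$ means the intersection $l\cap D$ with $l$ a complex linear subspace of the ambient vector space. The graph in (ii) is $\{(w,f(w)):w\in\Delta\}$ with $f:\Delta\to\mathbb{B}^{n-1}$ holomorphic; the graph in (iii) is $\{(g(z),z):z\in l\cap\mathbb{B}^{n-1}\}$ with $g$ holomorphic and $\Delta$-valued. *)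

theory Defs
  imports "HOL-Complex_Analysis.Complex_Analysis"
begin

text \<open>
  The ambient space \<open>\<complex>\<^sup>n = \<complex> \<times> \<complex>\<^sup>n\<^sup>-\<^sup>1\<close> is the type \<open>complex \<times> (complex ^ 'm)\<close> with
  \<open>CARD('m) = n - 1\<close>. Since index types are nonempty, \<open>n \<ge> 2\<close> is automatic. The following
  provides its complex vector space structure: \<open>cprod.scale\<close> is the componentwise scalar
  multiplication, \<open>cprod.p.subspace\<close> and \<open>cprod.p.dim\<close> are the complex notions on the product, as
  \<open>vec.subspace\<close> and \<open>vec.dim\<close> are on \<open>complex ^ 'm\<close>. (The unqualified \<open>subspace\<close> and \<open>dim\<close>
  are the real notions.)
\<close>

interpretation cprod: finite_dimensional_vector_space_prod
  "(*) :: complex \<Rightarrow> complex \<Rightarrow> complex" "(*s) :: complex \<Rightarrow> complex ^ 'm \<Rightarrow> complex ^ 'm"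
  "{1}" "cart_basis"
  by unfold_locales

abbreviation unit_disc :: "complex set"
  where "unit_disc \<equiv> ball 0 1"

text \<open>The norm of \<open>complex ^ 'm\<close> is the Euclidean (Hermitian) one.\<close>

abbreviation unit_ball :: "(complex ^ 'm) set"
  where "unit_ball \<equiv> ball 0 1"

text \<open>
  Holomorphy as Frechet differentiability with a complex linear derivative, where \<open>s\<close> and \<open>t\<close>
  are the complex scalar multiplications of the source and the target. Because the derivative is
  taken within \<open>S\<close>, this is the usual notion both for open \<open>S\<close> and for \<open>S\<close> relatively open in a
  complex linear subspace \<open>l\<close>: there only the restriction of \<open>f'\<close> to \<open>l\<close> matters, and a complex
  linear map on \<open>l\<close> always extends to the whole space.
\<close>

definition holomorphic_map_on ::
    "(complex \<Rightarrow> 'a \<Rightarrow> 'a) \<Rightarrow> (complex \<Rightarrow> 'b \<Rightarrow> 'b) \<Rightarrow>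
      ('a::real_normed_vector \<Rightarrow> 'b::real_normed_vector) \<Rightarrow> 'a set \<Rightarrow> bool"
  where "holomorphic_map_on s t f S \<longleftrightarrow>
    (\<forall>x\<in>S. \<exists>f'. Vector_Spaces.linear s t f' \<and> (f has_derivative f') (at x within S))"

lemma holomorphic_map_on_complex_iff:
  "holomorphic_map_on (*) (*) f S \<longleftrightarrow> f holomorphic_on S"
proof -
  have lin: "Vector_Spaces.linear (*) (*) f' \<longleftrightarrow> (\<exists>c. f' = (*) c)" for f' :: "complex \<Rightarrow> complex"
  proof
    assume "Vector_Spaces.linear (*) (*) f'"
    then interpret Vector_Spaces.linear "(*)" "(*)" f' .
    have "f' z = f' 1 * z" for z
      using scale[of z 1] by (simp add: mult.commute)
    then show "\<exists>c. f' = (*) c"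
      by blast
  next
    assume "\<exists>c. f' = (*) c"
    then show "Vector_Spaces.linear (*) (*) f'"
      by unfold_locales (auto simp: algebra_simps)
  qed
  show ?thesis
    unfolding holomorphic_map_on_def holomorphic_on_def field_differentiable_def
      has_field_derivative_def lin by blast
qed

definition holomorphic_retract ::
    "(complex \<Rightarrow> 'a \<Rightarrow> 'a) \<Rightarrow> 'a::real_normed_vector set \<Rightarrow> 'a set \<Rightarrow> bool"
  where "holomorphic_retract s X Z \<longleftrightarrow>
    (\<exists>r. holomorphic_map_on s s r X \<and> r ` X \<subseteq> X \<and> (\<forall>x\<in>X. r (r x) = r x) \<and> Z = r ` X)"

end

theory Submission
  imports Defs
begin

text \<open>
  Let \<open>r\<close> be the retraction and \<open>P\<close> its derivative at \<open>0\<close>, an idempotent linear map. By the Schwarz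
  lemma, tested with the linear functionals of norm at most one for the max norm of
  \<open>\<complex> \<times> \<complex>\<^sup>n\<^sup>-\<^sup>1\<close>, \<open>P\<close> maps the domain \<open>D = \<Delta> \<times> B\<close> into itself. A Cartan type uniqueness argument for
  \<open>r \<circ> P \<circ> r\<close> and \<open>r\<close> shows \<open>r \<circ> P \<circ> r = r\<close>, so \<open>Z = r (L \<inter> D)\<close> with \<open>L\<close> the range of \<open>P\<close>.
  The equality case of the Schwarz lemma gives, for \<open>(a, b) \<in> L \<inter> D\<close>, that \<open>r\<close> keeps the first
  coordinate if \<open>|b| \<le> |a|\<close> and the second one if \<open>|a| \<le> |b|\<close>. If \<open>|a| \<le> |b|\<close> on all of \<open>L\<close> this is
  case (iii). Otherwise \<open>r\<close> keeps the first coordinate on all of \<open>L \<inter> D\<close> by the identity theorem;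
  either \<open>L\<close> is a line projecting isomorphically to the first factor, which is case (ii), or \<open>L\<close>
  contains some \<open>(0, b) \<noteq> 0\<close>, then \<open>r\<close> also keeps the second coordinate, and this is case (iv).
  Case (i) is subsumed by (ii).
\<close>

section \<open>The Schwarz lemma for zeros of higher order\<close>

text \<open>The quotient \<open>h z / z\<close> has a removable singularity at \<open>0\<close>, and
  the Schwarz lemma bounds it. That lemma wants a strict bound by one, so it is applied to
  \<open>h / (M + e)\<close> and \<open>e\<close> is removed at the end. This also covers
  \<open>M = 0\<close>.\<close>

lemma Schwarz_quotient:
  assumes holf: "h holomorphic_on ball 0 1" and h0: "h 0 = 0"
    and M: "\<And>z. norm z < 1 \<Longrightarrow> norm (h z) \<le> M"
  obtains g where "g holomorphic_on ball 0 1" "\<And>z. norm z < 1 \<Longrightarrow> h z = z * g z"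
    "\<And>z. norm z < 1 \<Longrightarrow> norm (g z) \<le> M"
proof
  let ?g = "\<lambda>z. if z = 0 then deriv h 0 else (h z - h 0) / (z - 0)"
  show "?g holomorphic_on ball 0 1"
    by (rule pole_lemma_open[OF holf]) simp
  show "h z = z * ?g z" for z
    using h0 by auto
  show "norm (?g z) \<le> M" if z: "norm z < 1" for z
  proof (rule field_le_epsilon)
    fix e :: real assume "e > 0"
    let ?M = "M + e"
    have "0 \<le> M"
      using M[of 0] h0 by simp
    then have pos: "0 < ?M"
      using \<open>e > 0\<close> by simp
    have holk: "(\<lambda>z. h z / ?M) holomorphic_on ball 0 1"
      using pos by (intro holomorphic_intros holf) (auto simp flip: of_real_add)
    have bd: "norm (h z / ?M) < 1" if "norm z < 1" for z
      using M[OF that] pos \<open>e > 0\<close> by (simp add: norm_divide flip: of_real_add)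
    have "norm (deriv (\<lambda>z. h z / ?M) 0) \<le> 1" "norm (h z / ?M) \<le> norm z"
      using Schwarz_Lemma[OF holk _ bd z] h0 by auto
    moreover have "deriv (\<lambda>z. h z / ?M) 0 = deriv h 0 / ?M"
      by (rule deriv_cdivide_right) (use holf in \<open>auto intro: holomorphic_on_imp_differentiable_at\<close>)
    ultimately show "norm (?g z) \<le> ?M"
      using pos h0 by (auto simp: norm_divide field_simps simp flip: of_real_add)
  qed
qed

text \<open>The limit hypothesis says that \<open>h\<close> vanishes to order at least
  \<open>k + 1\<close>. Each induction step splits off one factor \<open>z\<close>, and the quotient
  keeps the same bound \<open>M\<close>.\<close>

lemma Schwarz_higher_order:
  assumes "h holomorphic_on ball 0 1" and "\<And>z. norm z < 1 \<Longrightarrow> norm (h z) \<le> M"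
    and "((\<lambda>z. h z / z ^ k) \<longlongrightarrow> 0) (at 0)" and "norm z < 1"
  shows "norm (h z) \<le> M * norm z ^ Suc k"
  using assms
proof (induction k arbitrary: h z)
  case (0 h z)
  have "isCont h 0"
    using holomorphic_on_imp_continuous_on[OF 0(1)] by (simp add: continuous_on_eq_continuous_at)
  then have "h 0 = 0"
    using 0(3) LIM_unique[of h _ 0] by (auto simp: isCont_def)
  then obtain g where "g holomorphic_on ball 0 1" "\<And>z. norm z < 1 \<Longrightarrow> h z = z * g z"
      "\<And>z. norm z < 1 \<Longrightarrow> norm (g z) \<le> M"
    using Schwarz_quotient[OF 0(1) _ 0(2)] by metis
  then show ?case
    using 0(4) by (simp add: norm_mult mult.commute[of _ "norm z"] mult_left_mono)
next
  case (Suc k h z)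
  \<comment> \<open>Multiplying back by \<open>z ^ Suc k\<close> shows that \<open>h\<close> itself
    tends to \<open>0\<close>, so \<open>h 0 = 0\<close> by continuity and a factor \<open>z\<close>
    can be split off.\<close>
  have "((\<lambda>z. h z / z ^ Suc k * z ^ Suc k) \<longlongrightarrow> 0 * 0 ^ Suc k) (at 0)"
    by (intro tendsto_intros Suc)
  then have lim: "(h \<longlongrightarrow> 0) (at 0)"
    by (simp del: power_Suc) (rule Lim_transform_eventually, assumption,
        auto simp: eventually_at_filter simp del: power_Suc)
  have "isCont h 0"
    using holomorphic_on_imp_continuous_on[OF Suc(2)] by (simp add: continuous_on_eq_continuous_at)
  then have "h 0 = 0"
    using lim LIM_unique[of h _ 0] by (auto simp: isCont_def)
  then obtain g where g: "g holomorphic_on ball 0 1" "\<And>z. norm z < 1 \<Longrightarrow> h z = z * g z"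
      "\<And>z. norm z < 1 \<Longrightarrow> norm (g z) \<le> M"
    using Schwarz_quotient[OF Suc(2) _ Suc(3)] by metis
  have "((\<lambda>z. g z / z ^ k) \<longlongrightarrow> 0) (at 0)"
  proof (rule Lim_transform_within_open[OF Suc(4)])
    show "open (ball 0 1 :: complex set)" by simp
    show "h z / z ^ Suc k = g z / z ^ k" if "z \<in> ball 0 1" "z \<noteq> 0" for z
      using that g(2) by simp
  qed simp
  then have "norm (g z) \<le> M * norm z ^ Suc k"
    by (intro Suc.IH[OF g(1)] g(3) Suc(5))
  then have "norm z * norm (g z) \<le> norm z * (M * norm z ^ Suc k)"
    by (rule mult_left_mono) simp
  then show ?case
    using g(2)[OF Suc(5)] by (simp add: norm_mult mult_ac)
qed

section \<open>The max norm and its dual ball\<close>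

text \<open>\<open>Vector_Spaces.linear\<close> carries no topology. A complex linear map is real
  linear once both scalar multiplications extend the real ones, and a finite-dimensional source then
  makes it bounded, as the derivative rules require.\<close>

lemma complex_linear_imp_bounded_linear:
  fixes f :: "'a::euclidean_space \<Rightarrow> 'b::real_normed_vector"
  assumes "Vector_Spaces.linear s t f"
    and "\<And>r x. s (complex_of_real r) x = r *\<^sub>R x" and "\<And>r x. t (complex_of_real r) x = r *\<^sub>R x"
  shows "bounded_linear f"
proof -
  interpret Vector_Spaces.linear s t f by fact
  have "linear f"
    using assms(2,3) add scale by (intro linearI) metis+
  then show ?thesis
    by (simp add: linear_conv_bounded_linear)
qed

lemma scale_of_real_vec: "complex_of_real r *s x = r *\<^sub>R (x :: complex ^ 'm)"
  unfolding vec_eq_iff vector_smult_component vector_scaleR_component by (simp add: scaleR_conv_of_real)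

lemma scale_of_real_prod: "cprod.scale (of_real r) x = r *\<^sub>R (x :: complex \<times> (complex ^ 'm))"
  by (simp add: prod_eq_iff cprod.scale_def scale_of_real_vec) (simp add: scaleR_conv_of_real)

lemmas cprod_linear_bounded =
  complex_linear_imp_bounded_linear[OF _ scale_of_real_prod scale_of_real_prod]
lemmas cprod_functional_bounded =
  complex_linear_imp_bounded_linear[of cprod.scale "(*)", OF _ scale_of_real_prod scaleR_conv_of_real[symmetric]]

lemma linear_cprod_scale_left: "Vector_Spaces.linear (*) cprod.scale (\<lambda>z. cprod.scale z u)"
  by unfold_locales (simp_all add: cprod.p.scale_left_distrib)

lemma bounded_linear_cprod_scale_left: "bounded_linear (\<lambda>z. cprod.scale z u)"
  by (rule complex_linear_imp_bounded_linear[OF linear_cprod_scale_left])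
     (simp_all add: scale_of_real_prod scaleR_conv_of_real)

lemma norm_scale_vec: "norm (c *s v) = norm c * norm (v :: complex ^ 'm)"
  by (simp add: norm_vec_def norm_mult L2_set_right_distrib)

text \<open>The standard Hermitian inner product, conjugate linear in the first argument so that
  \<open>hprod v\<close> is complex linear.\<close>

definition hprod :: "complex ^ 'm \<Rightarrow> complex ^ 'm \<Rightarrow> complex"
  where "hprod v z = (\<Sum>i\<in>UNIV. cnj (v $ i) * z $ i)"

lemma norm_hprod_le: "norm (hprod v z) \<le> norm v * norm z"
proof -
  have "norm (hprod v z) \<le> (\<Sum>i\<in>UNIV. norm (v $ i) * norm (z $ i))"
    unfolding hprod_def by (rule order_trans[OF norm_sum]) (simp add: norm_mult)
  also have "\<dots> \<le> norm v * norm z"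
    using L2_set_mult_ineq[of "\<lambda>i. norm (v $ i)" "\<lambda>i. norm (z $ i)" UNIV] by (simp add: norm_vec_def)
  finally show ?thesis .
qed

lemma Re_hprod: "Re (hprod v z) = v \<bullet> z"
  by (simp add: hprod_def inner_vec_def inner_complex_def)

lemma hprod_self: "hprod v v = of_real ((norm v)\<^sup>2)"
proof -
  have "hprod v v = of_real (\<Sum>i\<in>UNIV. (norm (v $ i))\<^sup>2)"
    by (simp add: hprod_def complex_norm_square[symmetric] mult.commute)
  also have "(\<Sum>i\<in>UNIV. (norm (v $ i))\<^sup>2) = (norm v)\<^sup>2"
    by (simp add: norm_vec_def L2_set_def real_sqrt_pow2[OF sum_nonneg])
  finally show ?thesis .
qed

lemma linear_hprod: "Vector_Spaces.linear (*s) (*) (hprod v)"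
  by unfold_locales (auto simp: hprod_def algebra_simps sum.distrib sum_distrib_left)

lemma hprod_scale_left: "hprod (c *s v) z = cnj c * hprod v z"
  by (simp add: hprod_def sum_distrib_left mult_ac)

text \<open>The Minkowski functional of the domain: its open unit ball is
  \<open>unit_disc \<times> unit_ball\<close>, whereas the library norm on a product is
  Euclidean.\<close>

definition mnorm :: "complex \<times> (complex ^ 'm) \<Rightarrow> real"
  where "mnorm x = max (norm (fst x)) (norm (snd x))"

lemma mnorm_less_1_iff: "mnorm x < 1 \<longleftrightarrow> x \<in> unit_disc \<times> unit_ball"
  by (cases x) (simp add: mnorm_def)

lemma mnorm_scale: "mnorm (cprod.scale c x) = norm c * mnorm x"
  by (simp add: mnorm_def cprod.scale_def norm_mult norm_scale_vec max_mult_distrib_left)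

lemma mnorm_triangle: "mnorm (x + y) \<le> mnorm x + mnorm y"
  unfolding mnorm_def fst_add snd_add by (smt (verit) norm_triangle_ineq)

lemma mnorm_nonneg: "0 \<le> mnorm x"
  by (simp add: mnorm_def le_max_iff_disj)

lemma mnorm_le_norm: "mnorm x \<le> norm x"
  using norm_fst_le[of "fst x" "snd x"] norm_snd_le[of "snd x" "fst x"] by (simp add: mnorm_def)

lemma mnorm_eq_0_iff: "mnorm x = 0 \<longleftrightarrow> x = 0"
  by (cases x) (auto simp: mnorm_def zero_prod_def max_def)

lemma mnorm_0: "mnorm 0 = 0"
  by (simp add: mnorm_eq_0_iff)

text \<open>The closed unit ball of the complex dual of \<open>mnorm\<close>. Composition with its
  elements turns maps into scalar functions, to which one-variable theorems apply.\<close>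

definition dual_ball :: "(complex \<times> (complex ^ 'm) \<Rightarrow> complex) set"
  where "dual_ball = {l. Vector_Spaces.linear cprod.scale (*) l \<and> (\<forall>x. norm (l x) \<le> mnorm x)}"

lemma fst_dual_ball: "fst \<in> dual_ball"
  by (simp add: dual_ball_def mnorm_def cprod.linear_fst)

lemma hprod_dual_ball:
  assumes "norm v \<le> 1"
  shows "(\<lambda>x. hprod v (snd x)) \<in> dual_ball"
proof -
  have "norm (hprod v (snd x)) \<le> mnorm x" for x
    using norm_hprod_le[of v "snd x"] mult_right_mono[OF assms, of "norm (snd x)"]
    by (simp add: mnorm_def)
  moreover have "Vector_Spaces.linear cprod.scale (*) (\<lambda>x. hprod v (snd x))"
    using Vector_Spaces.linear_compose[OF cprod.linear_snd linear_hprod] by (simp add: comp_def)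
  ultimately show ?thesis
    by (simp add: dual_ball_def del: split_paired_All)
qed

text \<open>An explicit norming functional: \<open>fst\<close> if the first factor dominates,
  otherwise the pairing with the normalised second component.\<close>

lemma mnorm_attained: "\<exists>l\<in>dual_ball. norm (l x) = mnorm x"
proof (cases "norm (snd x) \<le> norm (fst x)")
  case True
  then show ?thesis
    using fst_dual_ball by (intro bexI[of _ fst]) (simp_all add: mnorm_def)
next
  case False
  then have "snd x \<noteq> 0"
    by auto
  define v where "v = complex_of_real (inverse (norm (snd x))) *s snd x"
  have "norm v = 1"
    using \<open>snd x \<noteq> 0\<close> by (simp add: v_def norm_scale_vec norm_inverse)
  moreover have "norm (hprod v (snd x)) = norm (snd x)"
    using \<open>snd x \<noteq> 0\<close>
    by (simp add: v_def hprod_scale_left hprod_self norm_mult norm_inverse norm_power power2_eq_square)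
  ultimately show ?thesis
    using False hprod_dual_ball[of v] by (intro bexI[of _ "\<lambda>x. hprod v (snd x)"]) (simp_all add: mnorm_def)
qed

lemma mnorm_leI:
  assumes "\<And>l. l \<in> dual_ball \<Longrightarrow> norm (l x) \<le> c"
  shows "mnorm x \<le> c"
  using assms mnorm_attained[of x] by force

section \<open>Holomorphic maps on slices\<close>

lemma open_disc_times_ball: "open (unit_disc \<times> unit_ball)"
  by (simp add: open_Times)

text \<open>Places \<open>x\<close> at the parameter \<open>mnorm x\<close> of a linear disc through
  the origin that sweeps out a slice of the domain.\<close>

lemma mnorm_polar:
  obtains u where "mnorm u = 1" "x = cprod.scale (of_real (mnorm x)) u"
proof (cases "x = 0")
  case True
  then show ?thesis
    by (intro that[of "(1, 0)"]) (simp_all add: mnorm_def cprod.scale_def zero_prod_def)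
next
  case False
  then have "mnorm x \<noteq> 0"
    by (simp add: mnorm_eq_0_iff)
  then show ?thesis
    using mnorm_nonneg[of x]
    by (intro that[of "cprod.scale (of_real (inverse (mnorm x))) x"])
       (simp_all add: mnorm_scale norm_inverse)
qed

lemma mnorm_diff_le: "mnorm (x - y) \<le> mnorm x + mnorm y"
  unfolding mnorm_def fst_diff snd_diff by (smt (verit) norm_triangle_ineq4)

lemma dual_ballD:
  assumes "l \<in> dual_ball"
  shows "Vector_Spaces.linear cprod.scale (*) l" "norm (l x) \<le> mnorm x"
    "bounded_linear l" "l (x - y) = l x - l y" "l (cprod.scale c x) = c * l x"
    "l 0 = 0"
proof -
  show lin: "Vector_Spaces.linear cprod.scale (*) l" and "norm (l x) \<le> mnorm x"
    using assms by (simp_all add: dual_ball_def del: split_paired_All)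
  then show "bounded_linear l"
    by (blast intro: cprod_functional_bounded)
  interpret Vector_Spaces.linear cprod.scale "(*)" l
    by fact
  show "l (x - y) = l x - l y" "l (cprod.scale c x) = c * l x" "l 0 = 0"
    by (simp_all add: diff scale zero)
qed

lemma holomorphic_map_on_disc_times_ballD:
  assumes "holomorphic_map_on s t F (unit_disc \<times> unit_ball)" and "mnorm x < 1"
  obtains F' where "Vector_Spaces.linear s t F'" "(F has_derivative F') (at x)"
  using assms at_within_open[OF _ open_disc_times_ball, of x]
  unfolding holomorphic_map_on_def mnorm_less_1_iff by metis

text \<open>The chain rule along a complex line. Complex linearity of \<open>F'\<close> turns the
  real derivative into multiplication by the number \<open>l (F' u)\<close>.\<close>

lemma has_field_derivative_slice:
  assumes lin: "Vector_Spaces.linear cprod.scale cprod.scale F'"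
    and F': "(F has_derivative F') (at (a + cprod.scale z u))" and l: "l \<in> dual_ball"
  shows "((\<lambda>z. l (F (a + cprod.scale z u))) has_field_derivative l (F' u)) (at z)"
proof -
  interpret F': Vector_Spaces.linear cprod.scale cprod.scale F' by fact
  have "((\<lambda>z. a + cprod.scale z u) has_derivative (\<lambda>h. cprod.scale h u)) (at z)"
    using has_derivative_add[OF has_derivative_const bounded_linear.has_derivative[OF bounded_linear_cprod_scale_left has_derivative_ident]]
    by simp
  then have "((\<lambda>z. F (a + cprod.scale z u)) has_derivative (\<lambda>h. F' (cprod.scale h u))) (at z)"
    by (rule has_derivative_compose) (rule F')
  from bounded_linear.has_derivative[OF dual_ballD(3)[OF l] this]
  have "((\<lambda>z. l (F (a + cprod.scale z u))) has_derivative (\<lambda>h. l (F' (cprod.scale h u)))) (at z)" .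
  moreover have "(\<lambda>h. l (F' (cprod.scale h u))) = (*) (l (F' u))"
    by (simp add: fun_eq_iff dual_ballD[OF l] F'.scale)
  ultimately show ?thesis
    by (simp add: has_field_derivative_def)
qed

lemma holomorphic_on_slice:
  assumes F: "holomorphic_map_on cprod.scale cprod.scale F (unit_disc \<times> unit_ball)"
    and l: "l \<in> dual_ball" and T: "\<And>z. z \<in> T \<Longrightarrow> mnorm (a + cprod.scale z u) < 1"
  shows "(\<lambda>z. l (F (a + cprod.scale z u))) holomorphic_on T"
  unfolding holomorphic_on_def
proof
  fix z assume "z \<in> T"
  then obtain F' where F': "Vector_Spaces.linear cprod.scale cprod.scale F'"
      "(F has_derivative F') (at (a + cprod.scale z u))"
    using holomorphic_map_on_disc_times_ballD[OF F T] by metis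
  from has_field_derivative_slice[OF this l]
  show "(\<lambda>z. l (F (a + cprod.scale z u))) field_differentiable at z within T"
    using field_differentiable_at_within field_differentiable_def by blast
qed

lemma holomorphic_map_on_diff:
  assumes "holomorphic_map_on cprod.scale cprod.scale F S" "holomorphic_map_on cprod.scale cprod.scale G S"
  shows "holomorphic_map_on cprod.scale cprod.scale (\<lambda>x. F x - G x) S"
  unfolding holomorphic_map_on_def
proof
  fix x assume "x \<in> S"
  then obtain F' G' where FG: "Vector_Spaces.linear cprod.scale cprod.scale F'" "(F has_derivative F') (at x within S)"
      "Vector_Spaces.linear cprod.scale cprod.scale G'" "(G has_derivative G') (at x within S)"
    using assms unfolding holomorphic_map_on_def by metis
  interpret F: Vector_Spaces.linear cprod.scale cprod.scale F' by fact
  interpret G: Vector_Spaces.linear cprod.scale cprod.scale G' by fact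
  have "Vector_Spaces.linear cprod.scale cprod.scale (\<lambda>h. F' h - G' h)"
    by unfold_locales (simp_all add: F.add G.add F.scale G.scale cprod.p.scale_right_diff_distrib)
  then show "\<exists>f'. Vector_Spaces.linear cprod.scale cprod.scale f' \<and> ((\<lambda>x. F x - G x) has_derivative f') (at x within S)"
    using has_derivative_diff[OF FG(2,4)] by blast
qed

definition holomorphic_self_map :: "(complex \<times> (complex ^ 'm) \<Rightarrow> complex \<times> (complex ^ 'm)) \<Rightarrow> bool"
  where "holomorphic_self_map F \<longleftrightarrow>
    holomorphic_map_on cprod.scale cprod.scale F (unit_disc \<times> unit_ball) \<and> (\<forall>x. mnorm x < 1 \<longrightarrow> mnorm (F x) < 1)"

lemma holomorphic_self_mapD:
  assumes "holomorphic_self_map F"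
  shows "holomorphic_map_on cprod.scale cprod.scale F (unit_disc \<times> unit_ball)" "mnorm x < 1 \<Longrightarrow> mnorm (F x) < 1"
  using assms by (auto simp: holomorphic_self_map_def simp del: split_paired_All)

lemma holomorphic_self_map_id: "holomorphic_self_map (\<lambda>x. x)"
  unfolding holomorphic_self_map_def holomorphic_map_on_def
  using cprod.p.linear_ident has_derivative_ident by blast

lemma holomorphic_self_map_compose:
  fixes F :: "complex \<times> (complex ^ 'm) \<Rightarrow> complex \<times> (complex ^ 'm)"
  assumes F: "holomorphic_self_map F" and G: "holomorphic_self_map G"
  shows "holomorphic_self_map (\<lambda>x. F (G x))"
  unfolding holomorphic_self_map_def holomorphic_map_on_def
proof (intro conjI allI ballI impI)
  fix x :: "complex \<times> (complex ^ 'm)"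
  show "mnorm (F (G x)) < 1" if "mnorm x < 1"
    using that assms holomorphic_self_mapD(2) by blast
  assume "x \<in> unit_disc \<times> unit_ball"
  then have x: "mnorm x < 1"
    by (simp add: mnorm_less_1_iff)
  obtain G' where G': "Vector_Spaces.linear cprod.scale cprod.scale G'" "(G has_derivative G') (at x)"
    using holomorphic_map_on_disc_times_ballD[OF holomorphic_self_mapD(1)[OF G] x] .
  obtain F' where F': "Vector_Spaces.linear cprod.scale cprod.scale F'" "(F has_derivative F') (at (G x))"
    using holomorphic_map_on_disc_times_ballD[OF holomorphic_self_mapD(1)[OF F] holomorphic_self_mapD(2)[OF G x]] .
  have "((\<lambda>x. F (G x)) has_derivative (\<lambda>h. F' (G' h))) (at x within unit_disc \<times> unit_ball)"
    using has_derivative_compose[OF G'(2) F'(2)] has_derivative_at_withinI by blast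
  moreover have "Vector_Spaces.linear cprod.scale cprod.scale (\<lambda>h. F' (G' h))"
    using Vector_Spaces.linear_compose[OF G'(1) F'(1)] by (simp add: comp_def)
  ultimately show "\<exists>f'. Vector_Spaces.linear cprod.scale cprod.scale f' \<and>
      ((\<lambda>x. F (G x)) has_derivative f') (at x within unit_disc \<times> unit_ball)"
    by blast
qed

lemma holomorphic_self_map_funpow:
  assumes "holomorphic_self_map F"
  shows "holomorphic_self_map (F ^^ n)"
proof (induction n)
  case 0
  then show ?case
    using holomorphic_self_map_id by (simp add: id_def)
next
  case (Suc n)
  then show ?case
    using holomorphic_self_map_compose[OF assms] by (simp add: comp_def)
qed

text \<open>For each \<open>l\<close> in the dual ball, the one-variable Schwarz lemma applies to
  \<open>l \<circ> F\<close> on the disc through \<open>x\<close>; norming functionals turn these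
  bounds into one for \<open>mnorm\<close>.\<close>

lemma Schwarz_self_map:
  fixes F :: "complex \<times> (complex ^ 'm) \<Rightarrow> complex \<times> (complex ^ 'm)"
  assumes F: "holomorphic_self_map F" and F0: "F 0 = 0" and x: "mnorm x < 1"
  shows "mnorm (F x) \<le> mnorm x"
proof (rule mnorm_leI)
  fix l :: "complex \<times> (complex ^ 'm) \<Rightarrow> complex" assume l: "l \<in> dual_ball"
  obtain u where u: "mnorm u = 1" "x = cprod.scale (of_real (mnorm x)) u"
    by (rule mnorm_polar)
  have "norm (l (F (0 + cprod.scale (of_real (mnorm x)) u))) \<le> norm (complex_of_real (mnorm x))"
  proof (rule Schwarz_Lemma(1))
    show "(\<lambda>z. l (F (0 + cprod.scale z u))) holomorphic_on ball 0 1"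
      by (rule holomorphic_on_slice[OF holomorphic_self_mapD(1)[OF F] l]) (simp add: mnorm_scale u(1))
    show "norm (l (F (0 + cprod.scale z u))) < 1" if "norm z < 1" for z
      using dual_ballD(2)[OF l] holomorphic_self_mapD(2)[OF F] that
      by (metis add_0 le_less_trans mnorm_scale mult.right_neutral u(1))
  qed (use x F0 in \<open>simp_all add: dual_ballD[OF l] mnorm_nonneg\<close>)
  then show "norm (l (F x)) \<le> mnorm x"
    using u(2) by (simp add: mnorm_nonneg)
qed

text \<open>The derivative half of the Schwarz lemma on slices. It makes \<open>P\<close> a self map
  of the domain, so \<open>P\<close> can be composed with the retraction.\<close>

lemma Schwarz_self_map_derivative:
  fixes F :: "complex \<times> (complex ^ 'm) \<Rightarrow> complex \<times> (complex ^ 'm)"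
  assumes F: "holomorphic_self_map F" and F0: "F 0 = 0"
    and P: "(F has_derivative P) (at 0)" "Vector_Spaces.linear cprod.scale cprod.scale P"
  shows "mnorm (P x) \<le> mnorm x"
proof (rule mnorm_leI)
  fix l :: "complex \<times> (complex ^ 'm) \<Rightarrow> complex" assume l: "l \<in> dual_ball"
  obtain u where u: "mnorm u = 1" "x = cprod.scale (of_real (mnorm x)) u"
    by (rule mnorm_polar)
  have "norm (deriv (\<lambda>z. l (F (0 + cprod.scale z u))) 0) \<le> 1"
  proof (rule Schwarz_Lemma(2))
    show "(\<lambda>z. l (F (0 + cprod.scale z u))) holomorphic_on ball 0 1"
      by (rule holomorphic_on_slice[OF holomorphic_self_mapD(1)[OF F] l]) (simp add: mnorm_scale u(1))
    show "norm (l (F (0 + cprod.scale z u))) < 1" if "norm z < 1" for z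
      using dual_ballD(2)[OF l] holomorphic_self_mapD(2)[OF F] that
      by (metis add_0 le_less_trans mnorm_scale mult.right_neutral u(1))
    show "norm (0::complex) < 1" by simp
  qed (use F0 in \<open>simp_all add: dual_ballD[OF l]\<close>)
  moreover have "((\<lambda>z. l (F (0 + cprod.scale z u))) has_field_derivative l (P u)) (at 0)"
    by (rule has_field_derivative_slice[OF P(2) _ l]) (use P(1) in simp)
  ultimately have "norm (l (P u)) \<le> 1"
    using DERIV_imp_deriv by metis
  interpret P: Vector_Spaces.linear cprod.scale cprod.scale P by fact
  have "l (P x) = of_real (mnorm x) * l (P u)"
    by (subst u(2)) (simp add: P.scale dual_ballD[OF l])
  then show "norm (l (P x)) \<le> mnorm x"
    using \<open>norm (l (P u)) \<le> 1\<close> mnorm_nonneg[of x] by (simp add: norm_mult mult_left_le)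
qed

text \<open>The disc of radius \<open>t\<close> about \<open>a\<close> towards \<open>b\<close>
  stays where \<open>C\<close> bounds the function. The increment from the centre vanishes there and
  is at most \<open>2 * C\<close>, so \<open>Schwarz_quotient\<close> makes it linear in the
  parameter.\<close>

lemma holomorphic_Lipschitz:
  assumes F: "holomorphic_map_on cprod.scale cprod.scale F (unit_disc \<times> unit_ball)"
    and l: "l \<in> dual_ball" and t: "0 < t" "2 * t \<le> 1"
    and C: "\<And>x. mnorm x < 2 * t \<Longrightarrow> norm (l (F x)) \<le> C"
    and a: "mnorm a \<le> t" and ab: "mnorm (b - a) < t"
  shows "norm (l (F b) - l (F a)) \<le> 2 * C * (mnorm (b - a) / t)"
proof (cases "b = a")
  case True
  then show ?thesis by (simp add: mnorm_0)
next
  case False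
  define d where "d = mnorm (b - a)"
  have d: "0 < d" "d < t"
    using False ab mnorm_nonneg[of "b - a"] mnorm_eq_0_iff[of "b - a"] by (auto simp: d_def)
  \<comment> \<open>The direction \<open>b - a\<close> rescaled to \<open>mnorm\<close> equal to
    \<open>t\<close>; on the disc with centre \<open>a\<close>, the point \<open>b\<close> has
    parameter \<open>d / t < 1\<close>.\<close>
  define w where "w = cprod.scale (of_real (t / d)) (b - a)"
  have "mnorm w = t"
    using d by (simp add: w_def mnorm_scale norm_divide flip: d_def)
  have lt: "mnorm (a + cprod.scale z w) < 2 * t" if "norm z < 1" for z
  proof -
    have "mnorm (a + cprod.scale z w) \<le> mnorm a + norm z * t"
      using mnorm_triangle[of a "cprod.scale z w"] \<open>mnorm w = t\<close> by (simp add: mnorm_scale)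
    also have "\<dots> < t + 1 * t"
      using that a t(1) by (intro add_le_less_mono mult_strict_right_mono) auto
    finally show ?thesis by simp
  qed
  have "(\<lambda>z. l (F (a + cprod.scale z w))) holomorphic_on ball 0 1"
    by (rule holomorphic_on_slice[OF F l]) (use lt t in force)
  then have hol: "(\<lambda>z. l (F (a + cprod.scale z w)) - l (F a)) holomorphic_on ball 0 1"
    by (intro holomorphic_intros)
  have "norm (l (F a)) \<le> C"
    using C a t by simp
  then have bd: "norm (l (F (a + cprod.scale z w)) - l (F a)) \<le> 2 * C" if "norm z < 1" for z
    using C[OF lt[OF that]] norm_triangle_ineq4[of "l (F (a + cprod.scale z w))" "l (F a)"] by simp
  obtain g where g: "\<And>z. norm z < 1 \<Longrightarrow> l (F (a + cprod.scale z w)) - l (F a) = z * g z"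
      "\<And>z. norm z < 1 \<Longrightarrow> norm (g z) \<le> 2 * C"
    using Schwarz_quotient[OF hol _ bd]
    by (metis add.right_neutral cancel_comm_monoid_add_class.diff_cancel cprod.p.scale_zero_left)
  have "norm (complex_of_real (d / t)) < 1"
    using d by (simp add: norm_divide)
  moreover have "a + cprod.scale (of_real (d / t)) w = b"
    using d unfolding w_def cprod.p.scale_scale by (simp flip: of_real_mult of_real_divide)
  ultimately have "norm (l (F b) - l (F a)) = d / t * norm (g (of_real (d / t)))"
    using g(1)[of "of_real (d / t)"] d by (simp add: norm_mult norm_divide)
  also have "\<dots> \<le> d / t * (2 * C)"
    using g(2) \<open>norm (complex_of_real (d / t)) < 1\<close> d by (intro mult_left_mono) auto
  finally show ?thesis
    by (simp add: d_def mult.commute)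
qed

section \<open>Cartan uniqueness for retractions\<close>

text \<open>The error \<open>E\<close> may depend on \<open>m\<close>, the constant \<open>c\<close>
  may not. Choosing \<open>m\<close> beyond \<open>(c + 1) / e\<close> first and then waiting for
  \<open>E x < 1\<close> forces \<open>norm (q x) < e\<close>.\<close>

lemma tendsto_zero_multiples_bounded:
  fixes q :: "'a \<Rightarrow> 'b::real_normed_vector"
  assumes "\<And>m::nat. \<exists>E. (E \<longlongrightarrow> 0) F \<and> (\<forall>\<^sub>F x in F. real m * norm (q x) \<le> c + (E x :: real))"
  shows "(q \<longlongrightarrow> 0) F"
proof (rule tendstoI)
  fix e :: real assume "e > 0"
  obtain m :: nat where m: "(c + 1) / e < real m"
    using reals_Archimedean2 by blast
  \<comment> \<open>\<open>Suc m\<close> is used because the multiplier must be positive to be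
    cancelled.\<close>
  obtain E where E: "(E \<longlongrightarrow> 0) F" "\<forall>\<^sub>F x in F. real (Suc m) * norm (q x) \<le> c + (E x :: real)"
    using assms[of "Suc m"] by blast
  have "\<forall>\<^sub>F x in F. E x < 1"
    using order_tendstoD(2)[OF E(1), of 1] by simp
  with E(2) show "\<forall>\<^sub>F x in F. dist (q x) 0 < e"
  proof eventually_elim
    case (elim x)
    have "c + 1 < real (Suc m) * e"
      using m \<open>e > 0\<close> by (simp add: field_simps)
    with elim have "real (Suc m) * norm (q x) < real (Suc m) * e"
      by linarith
    then show ?case
      by (simp only: mult_less_cancel_left_pos of_nat_0_less_iff zero_less_Suc dist_norm diff_zero)
  qed
qed

text \<open>By idempotence of \<open>P\<close>, all positive iterates share the derivative
  \<open>P\<close> and hence agree with the retraction to first order at \<open>0\<close>.\<close>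

lemma has_derivative_funpow_idem:
  assumes f: "(f has_derivative P) (at 0)" and f0: "f 0 = 0" and P: "\<And>x. P (P x) = P x"
  shows "(f ^^ Suc n) 0 = 0 \<and> ((f ^^ Suc n) has_derivative P) (at 0)"
proof (induction n)
  case 0
  then show ?case using f f0 by simp
next
  case (Suc n)
  have "((\<lambda>x. f ((f ^^ Suc n) x)) has_derivative (\<lambda>h. P (P h))) (at 0)"
    by (rule has_derivative_compose[of _ P]) (use Suc f in auto)
  then show ?case
    using Suc f0 P by (simp add: comp_def)
qed

lemma slice_difference_quotient_tendsto_0:
  fixes F G :: "complex \<times> (complex ^ 'm) \<Rightarrow> complex \<times> (complex ^ 'm)"
  assumes "(F has_derivative P) (at 0)" "(G has_derivative P) (at 0)" "F 0 = G 0" and u: "mnorm u = 1"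
  shows "((\<lambda>z. mnorm (F (cprod.scale z u) - G (cprod.scale z u)) / norm z) \<longlongrightarrow> 0) (at 0)"
proof -
  have "((\<lambda>x. F x - G x) has_derivative (\<lambda>h. P h - P h)) (at (cprod.scale 0 u))"
    using has_derivative_diff[OF assms(1,2)] by simp
  from has_derivative_compose[OF bounded_linear.has_derivative[OF bounded_linear_cprod_scale_left has_derivative_ident] this]
  have "((\<lambda>z. F (cprod.scale z u) - G (cprod.scale z u)) has_derivative (\<lambda>h. 0)) (at 0)"
    by simp
  then have *: "((\<lambda>z. norm (F (cprod.scale z u) - G (cprod.scale z u)) / norm z) \<longlongrightarrow> 0) (at 0)"
    using assms(3) by (simp add: has_derivative_at)
  show ?thesis
    by (rule tendsto_sandwich[OF _ _ tendsto_const *])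
       (auto simp: mnorm_nonneg intro!: always_eventually divide_right_mono mnorm_le_norm)
qed

text \<open>
  With \<open>d = f - r\<close> of order \<open>k\<close> at \<open>0\<close>, each further iterate of \<open>f\<close> adds to \<open>f\<close> the same leading term
  of \<open>d\<close>. The iterates are bounded, so that term vanishes.
\<close>

lemma Cartan_retraction_aux:
  fixes f r :: "complex \<times> (complex ^ 'm) \<Rightarrow> complex \<times> (complex ^ 'm)"
  assumes f: "holomorphic_self_map f" "f 0 = 0" "(f has_derivative P) (at 0)"
    and r: "holomorphic_self_map r" "r 0 = 0" "(r has_derivative P) (at 0)"
    and P: "\<And>x. P (P x) = P x"
    and rf: "\<And>x. mnorm x < 1 \<Longrightarrow> r (f x) = f x" "\<And>x. mnorm x < 1 \<Longrightarrow> f (r x) = f x"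
      "\<And>x. mnorm x < 1 \<Longrightarrow> r (r x) = r x"
  shows "\<lbrakk>mnorm x < 1; l \<in> dual_ball\<rbrakk> \<Longrightarrow> norm (l (f x - r x)) \<le> 2 * mnorm x ^ k"
proof (induction k arbitrary: x l)
  case (0 x l)
  have "norm (l (f x - r x)) \<le> mnorm (f x) + mnorm (r x)"
    using dual_ballD(2)[OF 0(2)] mnorm_diff_le order_trans by blast
  then show ?case
    using holomorphic_self_mapD(2)[OF f(1) 0(1)] holomorphic_self_mapD(2)[OF r(1) 0(1)] by simp
next
  case (Suc k x l)
  note l = \<open>l \<in> dual_ball\<close>
  define d where "d = (\<lambda>x. f x - r x)"
  have hold: "holomorphic_map_on cprod.scale cprod.scale d (unit_disc \<times> unit_ball)"
    unfolding d_def by (intro holomorphic_map_on_diff holomorphic_self_mapD f r)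
  have IH: "norm (l (d y)) \<le> 2 * mnorm y ^ k" if "mnorm y < 1" for y
    using Suc.IH[OF that l] by (simp add: d_def)
  obtain u where u: "mnorm u = 1" "x = cprod.scale (of_real (mnorm x)) u"
    by (rule mnorm_polar)
  have mu: "mnorm (cprod.scale z u) = norm z" for z
    by (simp add: mnorm_scale u)
  \<comment> \<open>The index is shifted by one: the identity \<open>f ^^ 0\<close> need not have
    derivative \<open>P\<close>, nor values fixed by \<open>r\<close>.\<close>
  define g where "g = (\<lambda>n. f ^^ Suc n)"
  have g_0: "g 0 = f" and g_Suc: "g (Suc n) y = f (g n y)" for n y
    by (simp_all add: g_def)
  have fp: "holomorphic_self_map (g n)" "g n 0 = 0" "(g n has_derivative P) (at 0)" for n
    unfolding g_def
    using holomorphic_self_map_funpow[OF f(1), of "Suc n"] has_derivative_funpow_idem[OF f(3,2) P, of n]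
    by blast+
  have slice: "(\<lambda>z. l (F (cprod.scale z u))) holomorphic_on ball 0 1"
    if "holomorphic_map_on cprod.scale cprod.scale F (unit_disc \<times> unit_ball)" for F
    using holomorphic_on_slice[OF that l, of "ball 0 1" 0 u] by (simp add: mu)
  have rp: "r (g n y) = g n y" if "mnorm y < 1" for n y
    using rf(1)[OF that] rf(1)[OF holomorphic_self_mapD(2)[OF fp(1) that]]
    by (cases n) (simp_all only: g_0 g_Suc)
  \<comment> \<open>As \<open>r\<close> fixes \<open>g i y\<close>, the value
    \<open>d (g i y)\<close> is the increment from \<open>g i y\<close> to
    \<open>g (Suc i) y\<close>, and the sum telescopes.\<close>
  have tel: "l (g m y) - l (f y) = (\<Sum>i<m. l (d (g i y)))" if "mnorm y < 1" for m y
  proof -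
    have "l (d (g i y)) = l (g (Suc i) y) - l (g i y)" for i
      unfolding d_def rp[OF that] by (simp only: g_Suc dual_ballD(4)[OF l])
    then show ?thesis
      using sum_lessThan_telescope[of "\<lambda>i. l (g i y)" m] by (simp only: g_0)
  qed
  have fSuc: "mnorm (g n (cprod.scale z u)) \<le> norm z" if "norm z < 1" for n z
    using Schwarz_self_map[OF fp(1,2), of "cprod.scale z u"] that by (simp add: mu)
  have rz: "mnorm (r (cprod.scale z u)) \<le> norm z" if "norm z < 1" for z
    using Schwarz_self_map[OF r(1,2), of "cprod.scale z u"] that by (simp add: mu)
  have near_0: "\<forall>\<^sub>F z in at (0::complex). norm z < e \<and> z \<noteq> 0" if "e > 0" for e
    using that by (auto simp: eventually_at)
  \<comment> \<open>The bound is uniform in \<open>m\<close>. Telescoping gives only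
    \<open>2 * m * norm z ^ k\<close>, but this fixes the order of vanishing; since \<open>H\<close>
    is bounded by \<open>2\<close>, \<open>Schwarz_higher_order\<close> then replaces
    \<open>2 * m\<close> by \<open>2\<close>.\<close>
  have iterate_bound: "norm (l (g m (cprod.scale z u)) - l (f (cprod.scale z u))) \<le> 2 * norm z ^ k"
    if z: "norm z < 1" for m z
  proof -
    define H where "H = (\<lambda>z. l (g m (cprod.scale z u)) - l (f (cprod.scale z u)))"
    have holH: "H holomorphic_on ball 0 1"
      unfolding H_def by (intro holomorphic_on_diff slice holomorphic_self_mapD(1) fp f)
    have H2: "norm (H z) \<le> 2" if "norm z < 1" for z
    proof -
      have "norm (H z) \<le> norm z + norm z"
        unfolding H_def
        using norm_triangle_ineq4[of "l (g m (cprod.scale z u))" "l (f (cprod.scale z u))"]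
          dual_ballD(2)[OF l, of "g m (cprod.scale z u)"] dual_ballD(2)[OF l, of "f (cprod.scale z u)"]
          fSuc[OF that, of m] fSuc[OF that, of 0] unfolding g_0 by linarith
      then show ?thesis
        using that by simp
    qed
    have HO: "norm (H z) \<le> (2 * real m) * norm z ^ k" if "norm z < 1" for z
    proof -
      have "norm (H z) \<le> (\<Sum>i<m. norm (l (d (g i (cprod.scale z u)))))"
        unfolding H_def using tel[of "cprod.scale z u" m, unfolded mu, OF that] by (simp only: norm_sum)
      also have "\<dots> \<le> (\<Sum>i<m. 2 * norm z ^ k)"
      proof (rule sum_mono)
        fix i
        have "mnorm (g i (cprod.scale z u)) < 1"
          using fSuc[OF that, of i] that by simp
        from IH[OF this] show "norm (l (d (g i (cprod.scale z u)))) \<le> 2 * norm z ^ k"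
          using power_mono[OF fSuc[OF that] mnorm_nonneg, of i k] by linarith
      qed
      finally show ?thesis by simp
    qed
    have "norm (H z) \<le> 2 * norm z ^ k"
    proof (cases k)
      case 0
      then show ?thesis using H2[OF z] by simp
    next
      case (Suc j)
      have "((\<lambda>z. H z / z ^ j) \<longlongrightarrow> 0) (at 0)"
      proof (rule Lim_null_comparison)
        show "\<forall>\<^sub>F z in at 0. norm (H z / z ^ j) \<le> (2 * real m) * norm z"
          using near_0[OF zero_less_one]
        proof eventually_elim
          case (elim z)
          then show ?case
            using HO[of z] Suc by (simp add: norm_divide norm_power field_simps)
        qed
        show "((\<lambda>z::complex. 2 * real m * norm z) \<longlongrightarrow> 0) (at 0)"
          by (intro tendsto_mult_right_zero tendsto_norm_zero tendsto_ident_at)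
      qed
      from Schwarz_higher_order[OF holH H2 this z] show ?thesis
        using Suc by simp
    qed
    then show ?thesis by (simp add: H_def)
  qed

  \<comment> \<open>The comparison point is \<open>r (cprod.scale z u)\<close> because
    \<open>d (r y) = d y\<close>. So every telescoping summand is
    \<open>l (d (cprod.scale z u))\<close> up to an error \<open>e i z\<close>, which is of smaller
    order than \<open>z ^ k\<close>.\<close>
  define e where "e = (\<lambda>i z. l (d (g i (cprod.scale z u))) - l (d (r (cprod.scale z u))))"
  have e0: "((\<lambda>z. e i z / z ^ k) \<longlongrightarrow> 0) (at 0)" for i
  proof (rule Lim_null_comparison)
    let ?N = "\<lambda>z. mnorm (g i (cprod.scale z u) - r (cprod.scale z u)) / norm z"
    have N0: "(?N \<longlongrightarrow> 0) (at 0)"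
      by (rule slice_difference_quotient_tendsto_0) (use fp[of i] r u in simp_all)
    then show "((\<lambda>z. (2 * (2 * 2 ^ k)) * ?N z) \<longlongrightarrow> 0) (at 0)"
      by (rule tendsto_mult_right_zero)
    have "\<forall>\<^sub>F z in at 0. ?N z < 1"
      using order_tendstoD(2)[OF N0, of 1] by simp
    moreover have "\<forall>\<^sub>F z in at (0::complex). norm z < 1 / 2 \<and> z \<noteq> 0"
      by (rule near_0) simp
    ultimately show "\<forall>\<^sub>F z in at 0. norm (e i z / z ^ k) \<le> (2 * (2 * 2 ^ k)) * ?N z"
    proof eventually_elim
      case (elim z)
      then have z: "0 < norm z" "2 * norm z \<le> 1" "norm z < 1"
        by auto
      \<comment> \<open>The Lipschitz estimate at scale \<open>t = norm z\<close>: the induction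
        hypothesis bounds \<open>d\<close> on the doubled ball, and the relative distance
        \<open>?N z\<close> tends to \<open>0\<close>.\<close>
      have "norm (e i z) \<le> 2 * (2 * (2 * norm z) ^ k) * ?N z"
        unfolding e_def
      proof (rule holomorphic_Lipschitz[OF hold l z(1,2)])
        show "norm (l (d y)) \<le> 2 * (2 * norm z) ^ k" if "mnorm y < 2 * norm z" for y
          using IH[of y] power_mono[OF less_imp_le[OF that] mnorm_nonneg, of k] that z by linarith
        show "mnorm (r (cprod.scale z u)) \<le> norm z"
          using rz z by simp
        show "mnorm (g i (cprod.scale z u) - r (cprod.scale z u)) < norm z"
          using elim(1) z(1) by (simp only: divide_less_eq_1_pos)
      qed
      then have "norm (e i z) / norm z ^ k \<le> 2 * (2 * (2 * norm z) ^ k) * ?N z / norm z ^ k"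
        by (rule divide_right_mono) simp
      also have "\<dots> = (2 * (2 * 2 ^ k)) * ?N z"
        using z by (simp only: power_mult_distrib) simp
      finally show ?case
        by (simp add: norm_divide norm_power)
    qed
  qed

  \<comment> \<open>After division by \<open>z ^ k\<close>, the \<open>m\<close>-fold multiple of
    this quotient is at most \<open>2\<close> plus a null error for every \<open>m\<close>, so the
    term of order \<open>k\<close> vanishes.\<close>
  have "((\<lambda>z. l (d (cprod.scale z u)) / z ^ k) \<longlongrightarrow> 0) (at 0)"
  proof (rule tendsto_zero_multiples_bounded[where c = 2])
    fix m :: nat
    let ?E = "\<lambda>z. norm (\<Sum>i<m. e i z / z ^ k)"
    have "((\<lambda>z. \<Sum>i<m. e i z / z ^ k) \<longlongrightarrow> 0) (at 0)"
      by (rule tendsto_null_sum) (rule e0)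
    then have E: "(?E \<longlongrightarrow> 0) (at 0)"
      by (rule tendsto_norm_zero)
    have "\<forall>\<^sub>F z in at 0. real m * norm (l (d (cprod.scale z u)) / z ^ k) \<le> 2 + ?E z"
      using near_0[OF zero_less_one]
    proof eventually_elim
      case (elim z)
      then have z: "norm z < 1" "z \<noteq> 0" by auto
      let ?y = "cprod.scale z u"
      have dr: "d (r ?y) = d ?y"
        using rf z by (simp add: d_def mu)
      have "l (g m ?y) - l (f ?y) = of_nat m * l (d ?y) + (\<Sum>i<m. e i z)"
        unfolding tel[of ?y m, unfolded mu, OF z(1)] e_def dr by (simp add: sum_subtractf)
      then have "of_nat m * (l (d ?y) / z ^ k) =
          (l (g m ?y) - l (f ?y)) / z ^ k - (\<Sum>i<m. e i z / z ^ k)"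
        using z by (simp add: sum_divide_distrib[symmetric] field_simps)
      then have "norm (of_nat m * (l (d ?y) / z ^ k)) \<le>
          norm ((l (g m ?y) - l (f ?y)) / z ^ k) + ?E z"
        using norm_triangle_ineq4 by metis
      also have "norm ((l (g m ?y) - l (f ?y)) / z ^ k) \<le> 2"
        using iterate_bound[OF z(1), of m] z by (simp add: norm_divide norm_power divide_le_eq)
      finally show ?case
        by (simp only: norm_mult norm_of_nat)
    qed
    with E show "\<exists>E. (E \<longlongrightarrow> 0) (at 0) \<and>
        (\<forall>\<^sub>F z in at 0. real m * norm (l (d (cprod.scale z u)) / z ^ k) \<le> 2 + E z)"
      by blast
  qed
  moreover have "norm (l (d (cprod.scale z u))) \<le> 2" if "norm z < 1" for z
  proof -
    have "norm (l (d (cprod.scale z u))) \<le> 2 * norm z ^ k"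
      using IH[of "cprod.scale z u"] that by (simp add: mu)
    also have "\<dots> \<le> 2"
      using power_le_one[of "norm z" k] that by simp
    finally show ?thesis .
  qed
  ultimately have "norm (l (d (cprod.scale (of_real (mnorm x)) u))) \<le> 2 * norm (complex_of_real (mnorm x)) ^ Suc k"
    using Suc.prems(1) by (intro Schwarz_higher_order[OF slice[OF hold]]) (simp_all add: mnorm_nonneg)
  then show ?case
    using u(2) by (simp add: d_def mnorm_nonneg)
qed

text \<open>The preceding estimate holds for every \<open>k\<close>; since
  \<open>mnorm x < 1\<close>, letting \<open>k\<close> grow makes the difference vanish.\<close>

lemma Cartan_retraction:
  fixes f r :: "complex \<times> (complex ^ 'm) \<Rightarrow> complex \<times> (complex ^ 'm)"
  assumes f: "holomorphic_self_map f" "f 0 = 0" "(f has_derivative P) (at 0)"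
    and r: "holomorphic_self_map r" "r 0 = 0" "(r has_derivative P) (at 0)"
    and P: "\<And>x. P (P x) = P x"
    and rf: "\<And>x. mnorm x < 1 \<Longrightarrow> r (f x) = f x" "\<And>x. mnorm x < 1 \<Longrightarrow> f (r x) = f x"
      "\<And>x. mnorm x < 1 \<Longrightarrow> r (r x) = r x"
    and x: "mnorm x < 1"
  shows "f x = r x"
proof -
  have "norm (l (f x - r x)) \<le> 0" if "l \<in> dual_ball" for l
  proof (rule LIMSEQ_le_const)
    show "(\<lambda>k. 2 * mnorm x ^ k) \<longlonglongrightarrow> 0"
      using x mnorm_nonneg[of x] by (intro tendsto_mult_right_zero LIMSEQ_realpow_zero)
    show "\<exists>N. \<forall>n\<ge>N. norm (l (f x - r x)) \<le> 2 * mnorm x ^ n"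
      using Cartan_retraction_aux[OF f r P rf x that] by blast
  qed
  then have "mnorm (f x - r x) \<le> 0"
    by (rule mnorm_leI)
  then show ?thesis
    using mnorm_nonneg[of "f x - r x"] mnorm_eq_0_iff[of "f x - r x"] by simp
qed

section \<open>The equality case and the identity theorem\<close>

text \<open>On the disc through \<open>x\<close> the function \<open>l \<circ> F\<close> has
  derivative \<open>l u\<close> of modulus one at \<open>0\<close>. Equality in the Schwarz lemma
  makes it linear there.\<close>

lemma Schwarz_self_map_equality:
  fixes F :: "complex \<times> (complex ^ 'm) \<Rightarrow> complex \<times> (complex ^ 'm)"
  assumes F: "holomorphic_self_map F" and F0: "F 0 = 0"
    and P: "(F has_derivative P) (at 0)" "Vector_Spaces.linear cprod.scale cprod.scale P"
    and x: "P x = x" "mnorm x < 1" and l: "l \<in> dual_ball" "norm (l x) = mnorm x"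
  shows "l (F x) = l x"
proof (cases "x = 0")
  case True
  then show ?thesis using F0 by simp
next
  case False
  then have N: "0 < mnorm x"
    using mnorm_nonneg[of x] mnorm_eq_0_iff[of x] by linarith
  define u where "u = cprod.scale (of_real (inverse (mnorm x))) x"
  have u: "mnorm u = 1" "x = cprod.scale (of_real (mnorm x)) u"
    using N by (simp_all add: u_def mnorm_scale norm_inverse)
  interpret P: Vector_Spaces.linear cprod.scale cprod.scale P by fact
  have "((\<lambda>z. l (F (0 + cprod.scale z u))) has_field_derivative l (P u)) (at 0)"
    by (rule has_field_derivative_slice[OF P(2) _ l(1)]) (use P(1) in simp)
  moreover have "P u = u"
    by (simp add: u_def P.scale x)
  ultimately have deriv: "((\<lambda>z. l (F (cprod.scale z u))) has_field_derivative l u) (at 0)"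
    by simp
  have lu: "norm (l u) = 1"
    using N l by (simp add: u_def dual_ballD[OF l(1)] norm_mult norm_inverse)
  have "\<exists>\<alpha>. (\<forall>z. norm z < 1 \<longrightarrow> l (F (cprod.scale z u)) = \<alpha> * z) \<and> norm \<alpha> = 1"
  proof (rule Schwarz_Lemma(3))
    show "(\<lambda>z. l (F (cprod.scale z u))) holomorphic_on ball 0 1"
      using holomorphic_on_slice[OF holomorphic_self_mapD(1)[OF F] l(1), of "ball 0 1" 0 u]
      by (simp add: mnorm_scale u(1))
    show "norm (l (F (cprod.scale z u))) < 1" if "norm z < 1" for z
      using dual_ballD(2)[OF l(1)] holomorphic_self_mapD(2)[OF F] that
      by (metis le_less_trans mnorm_scale mult.right_neutral u(1))
    show "(\<exists>z. norm z < 1 \<and> z \<noteq> 0 \<and> norm (l (F (cprod.scale z u))) = norm z) \<or>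
        norm (deriv (\<lambda>z. l (F (cprod.scale z u))) 0) = 1"
      using DERIV_imp_deriv[OF deriv] lu by simp
    show "norm (0::complex) < 1" by simp
  qed (simp add: F0 dual_ballD[OF l(1)])
  then obtain \<alpha> where \<alpha>: "\<And>z. norm z < 1 \<Longrightarrow> l (F (cprod.scale z u)) = \<alpha> * z"
    by blast
  \<comment> \<open>The Schwarz lemma supplies some factor \<open>\<alpha>\<close>; comparing
    derivatives at \<open>0\<close> identifies it as \<open>l u\<close>.\<close>
  have "((\<lambda>z. l (F (cprod.scale z u))) has_field_derivative \<alpha>) (at 0)"
  proof (rule has_field_derivative_transform_within_open[where S = "ball 0 1"])
    show "((*) \<alpha> has_field_derivative \<alpha>) (at 0)"
      using DERIV_cmult_Id by blast
  qed (use \<alpha> in auto)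
  then have "\<alpha> = l u"
    using deriv DERIV_unique by blast
  then have "l (F (cprod.scale (of_real (mnorm x)) u)) = l u * of_real (mnorm x)"
    using \<alpha>[of "of_real (mnorm x)"] x by (simp add: mnorm_nonneg)
  also have "\<dots> = l (cprod.scale (of_real (mnorm x)) u)"
    by (simp add: dual_ballD[OF l(1)])
  finally show ?thesis
    using u(2) by simp
qed

lemma Schwarz_self_map_fst:
  assumes F: "holomorphic_self_map F" and F0: "F 0 = 0"
    and P: "(F has_derivative P) (at 0)" "Vector_Spaces.linear cprod.scale cprod.scale P"
    and x: "P x = x" "mnorm x < 1" and le: "norm (snd x) \<le> norm (fst x)"
  shows "fst (F x) = fst x"
  by (rule Schwarz_self_map_equality[OF F F0 P x fst_dual_ball]) (use le in \<open>simp add: mnorm_def\<close>)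

text \<open>The functional that norms \<open>snd x\<close> fixes only the component of
  \<open>snd (F x)\<close> along \<open>snd x\<close>. The Schwarz bound on its norm and strict
  convexity of the Euclidean ball give the rest.\<close>

lemma Schwarz_self_map_snd:
  fixes F :: "complex \<times> (complex ^ 'm) \<Rightarrow> complex \<times> (complex ^ 'm)"
  assumes F: "holomorphic_self_map F" and F0: "F 0 = 0"
    and P: "(F has_derivative P) (at 0)" "Vector_Spaces.linear cprod.scale cprod.scale P"
    and x: "P x = x" "mnorm x < 1" and le: "norm (fst x) \<le> norm (snd x)"
  shows "snd (F x) = snd x"
proof -
  have Nx: "mnorm x = norm (snd x)"
    using le by (simp add: mnorm_def)
  have nle: "norm (snd (F x)) \<le> norm (snd x)"
    using Schwarz_self_map[OF F F0 x(2)] unfolding Nx by (simp add: mnorm_def)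
  show ?thesis
  proof (cases "snd x = 0")
    case True
    then show ?thesis using nle by simp
  next
    case False
    define v where "v = complex_of_real (inverse (norm (snd x))) *s snd x"
    have hv: "hprod v y = of_real (inverse (norm (snd x))) * hprod (snd x) y" for y
      by (simp add: v_def hprod_scale_left)
    have "norm v \<le> 1"
      using False by (simp add: v_def norm_scale_vec norm_inverse)
    then have "hprod v (snd (F x)) = hprod v (snd x)"
      by (intro Schwarz_self_map_equality[OF F F0 P x hprod_dual_ball])
         (use False in \<open>simp_all add: hv hprod_self norm_mult norm_inverse norm_power power2_eq_square Nx\<close>)
    then have "hprod (snd x) (snd (F x)) = hprod (snd x) (snd x)"
      using False by (simp add: hv)
    then have "snd x \<bullet> snd (F x) = snd x \<bullet> snd x"
      by (metis Re_hprod)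
    moreover have "snd (F x) \<bullet> snd (F x) \<le> snd x \<bullet> snd x"
      using nle by (simp add: norm_le)
    ultimately have "(snd (F x) - snd x) \<bullet> (snd (F x) - snd x) \<le> 0"
      by (simp add: inner_diff inner_commute)
    then show ?thesis
      by (metis eq_iff_diff_eq_0 inner_ge_zero inner_eq_zero_iff order_antisym)
  qed
qed

text \<open>Within \<open>L\<close>, the complex line through \<open>p\<close> and \<open>x\<close>
  meets the domain in a convex parameter set \<open>T\<close>. The one-variable identity theorem
  carries the vanishing near parameter \<open>0\<close> to parameter \<open>1\<close>.\<close>

lemma slice_identity_theorem:
  fixes F :: "complex \<times> (complex ^ 'm) \<Rightarrow> complex \<times> (complex ^ 'm)"
  assumes F: "holomorphic_map_on cprod.scale cprod.scale F (unit_disc \<times> unit_ball)" and l: "l \<in> dual_ball"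
    and L: "cprod.p.subspace L" and U: "open U" and p: "p \<in> L" "p \<in> U" "mnorm p < 1"
    and 0: "\<And>y. \<lbrakk>y \<in> L; y \<in> U; mnorm y < 1\<rbrakk> \<Longrightarrow> l (F y) = 0"
    and x: "x \<in> L" "mnorm x < 1"
  shows "l (F x) = 0"
proof -
  define c where "c = (\<lambda>z. p + cprod.scale z (x - p))"
  define T where "T = c -` (unit_disc \<times> unit_ball)"
  have cont: "continuous_on UNIV c"
    unfolding c_def cprod.scale_def
    by (intro continuous_intros) (simp add: vector_scalar_mult_def continuous_intros)
  have T: "z \<in> T \<longleftrightarrow> mnorm (c z) < 1" for z
    by (simp add: T_def mnorm_less_1_iff)
  have opT: "open T" "open (T \<inter> c -` U)"
    unfolding T_def using cont open_disc_times_ball U by (auto intro!: open_Int open_vimage)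
  have "convex T"
  proof (rule convexI)
    fix z w and a b :: real
    assume zw: "z \<in> T" "w \<in> T" and ab: "0 \<le> a" "0 \<le> b" "a + b = 1"
    have "c (a *\<^sub>R z + b *\<^sub>R w) = (a + b) *\<^sub>R p + cprod.scale (of_real a * z + of_real b * w) (x - p)"
      by (simp add: c_def ab scaleR_conv_of_real)
    also have "\<dots> = a *\<^sub>R c z + b *\<^sub>R c w"
      by (simp only: c_def cprod.p.scale_left_distrib scaleR_add_left scaleR_add_right
          cprod.p.scale_scale[symmetric] scale_of_real_prod) simp
    also have "\<dots> \<in> unit_disc \<times> unit_ball"
      using zw ab by (intro convexD convex_Times convex_ball) (auto simp: T_def)
    finally show "a *\<^sub>R z + b *\<^sub>R w \<in> T"
      by (simp add: T_def)
  qed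
  have "l (F (c 1)) = 0"
  proof (rule analytic_continuation[where f = "\<lambda>z. l (F (c z))" and S = T and U = "T \<inter> c -` U" and \<xi> = 0])
    show "(\<lambda>z. l (F (c z))) holomorphic_on T"
      unfolding c_def by (rule holomorphic_on_slice[OF F l]) (use T in \<open>simp add: c_def\<close>)
    show "connected T"
      by (rule convex_connected) fact
    have "0 \<in> T \<inter> c -` U"
      using p by (simp add: T c_def)
    then show "0 islimpt T \<inter> c -` U" "0 \<in> T"
      using opT by (blast intro: interior_limit_point interiorI)+
    show "1 \<in> T"
      using x by (simp add: T c_def)
    show "l (F (c z)) = 0" if "z \<in> T \<inter> c -` U" for z
    proof (rule 0)
      show "c z \<in> L"
        unfolding c_def using L p x by (intro cprod.p.subspace_add cprod.p.subspace_scale cprod.p.subspace_diff)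
    qed (use that T in auto)
  qed (use opT in auto)
  then show ?thesis
    by (simp add: c_def)
qed

section \<open>The retract as the image of its tangent space at the origin\<close>

text \<open>Differentiating \<open>r \<circ> r = r\<close> at the fixed point \<open>0\<close> makes
  \<open>P\<close> idempotent. Each \<open>r x\<close> is then the image of \<open>P (r x)\<close>,
  a fixed point of \<open>P\<close> in the domain.\<close>

lemma retract_over_tangent_space:
  fixes Z :: "(complex \<times> (complex ^ 'm)) set"
  assumes retract: "holomorphic_retract cprod.scale (unit_disc \<times> unit_ball) Z" and "0 \<in> Z"
  obtains r P where "holomorphic_self_map r" "r 0 = 0" "(r has_derivative P) (at 0)"
    "Vector_Spaces.linear cprod.scale cprod.scale P" "Z = r ` {x. P x = x \<and> mnorm x < 1}"
proof -
  obtain r where r: "holomorphic_map_on cprod.scale cprod.scale r (unit_disc \<times> unit_ball)"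
      "r ` (unit_disc \<times> unit_ball) \<subseteq> unit_disc \<times> unit_ball"
      "\<forall>x\<in>unit_disc \<times> unit_ball. r (r x) = r x" and Z: "Z = r ` (unit_disc \<times> unit_ball)"
    using retract unfolding holomorphic_retract_def by blast
  have self: "holomorphic_self_map r"
    unfolding holomorphic_self_map_def using r(1,2) by (auto simp: mnorm_less_1_iff)
  have rr: "r (r x) = r x" if "mnorm x < 1" for x
    using that r(3) unfolding mnorm_less_1_iff by blast
  have r0: "r 0 = 0"
    using \<open>0 \<in> Z\<close> r(3) unfolding Z by (metis (no_types) imageE)
  obtain P where P: "Vector_Spaces.linear cprod.scale cprod.scale P" "(r has_derivative P) (at 0)"
    using holomorphic_map_on_disc_times_ballD[OF r(1), of 0] by (auto simp: mnorm_0)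
  have "((\<lambda>x. r (r x)) has_derivative (\<lambda>h. P (P h))) (at 0)"
    by (rule has_derivative_compose) (use P r0 in simp_all)
  then have "(r has_derivative (\<lambda>h. P (P h))) (at 0)"
    by (rule has_derivative_transform_within_open[OF _ open_disc_times_ball])
       (use rr in \<open>simp_all add: mnorm_less_1_iff[symmetric] mnorm_0 del: mem_Times_iff\<close>)
  then have PP: "P (P x) = P x" for x
    using has_derivative_unique[OF P(2)] by metis
  have PN: "mnorm (P x) \<le> mnorm x" for x
    by (rule Schwarz_self_map_derivative[OF self r0 P(2,1)])
  have Pder: "(P has_derivative P) (at x)" for x
    by (intro bounded_linear_imp_has_derivative cprod_linear_bounded P)
  have Pself: "holomorphic_self_map P"
    unfolding holomorphic_self_map_def holomorphic_map_on_def
  proof (intro conjI ballI allI impI exI)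
    show "(P has_derivative P) (at x within unit_disc \<times> unit_ball)" for x
      by (rule has_derivative_at_withinI) (rule Pder)
    show "mnorm (P x) < 1" if "mnorm x < 1" for x
      using PN that by (rule le_less_trans)
  qed (rule P(1))
  interpret P: Vector_Spaces.linear cprod.scale cprod.scale P by fact
  \<comment> \<open>The composite absorbs \<open>r\<close> on both sides because \<open>r\<close> is
    idempotent, and its derivative \<open>P \<circ> P \<circ> P\<close> collapses to
    \<open>P\<close>.\<close>
  have r_P_r: "r (P (r x)) = r x" if "mnorm x < 1" for x
  proof (rule Cartan_retraction[OF _ _ _ self r0 P(2) PP _ _ rr that])
    show "holomorphic_self_map (\<lambda>x. r (P (r x)))"
      by (intro holomorphic_self_map_compose[OF self] holomorphic_self_map_compose[OF Pself] self)
    show "r (P (r 0)) = 0"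
      by (simp add: r0 P.zero)
    have "((\<lambda>x. r (P (r x))) has_derivative (\<lambda>h. P (P (P h)))) (at 0)"
      by (intro has_derivative_compose[of r P 0 UNIV "\<lambda>y. r (P y)"] has_derivative_compose[of P P _ UNIV r P])
         (use P(2) Pder r0 P.zero in simp_all)
    then show "((\<lambda>x. r (P (r x))) has_derivative P) (at 0)"
      by (simp add: PP)
    show "r (r (P (r x))) = r (P (r x))" "r (P (r (r x))) = r (P (r x))" if "mnorm x < 1" for x
      using rr that holomorphic_self_mapD(2)[OF self that] PN le_less_trans by metis+
  qed
  have "Z = r ` {x. P x = x \<and> mnorm x < 1}"
  proof
    show "Z \<subseteq> r ` {x. P x = x \<and> mnorm x < 1}"
    proof
      fix y assume "y \<in> Z"
      then obtain x where x: "mnorm x < 1" "y = r x"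
        using Z by (auto simp: mnorm_less_1_iff simp del: mem_Times_iff)
      then show "y \<in> r ` {x. P x = x \<and> mnorm x < 1}"
        using r_P_r[OF x(1)] PP holomorphic_self_mapD(2)[OF self x(1)] PN[of "r x"]
        by (intro image_eqI[of _ _ "P (r x)"]) auto
    qed
    show "r ` {x. P x = x \<and> mnorm x < 1} \<subseteq> Z"
      unfolding Z by (intro image_mono) (auto simp: mnorm_less_1_iff simp del: mem_Times_iff)
  qed
  then show thesis
    by (rule that[OF self r0 P(2,1)])
qed

section \<open>Classification by the position of the tangent space\<close>

theorem theorem1p5:
  fixes Z :: "(complex \<times> (complex ^ 'm)) set"
  assumes retract: "holomorphic_retract cprod.scale (unit_disc \<times> unit_ball) Z"
    and origin: "0 \<in> Z"
    and nontrivial: "Z \<noteq> {0}"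
    and proper: "Z \<noteq> unit_disc \<times> unit_ball"
  shows
    "(\<exists>c \<in> frontier unit_ball. Z = {(w, \<chi> i. c $ i * w) | w. w \<in> unit_disc})
   \<or> (\<exists>f. holomorphic_map_on (*) (*s) f unit_disc \<and> f ` unit_disc \<subseteq> unit_ball
        \<and> Z = {(w, f w) | w. w \<in> unit_disc})
   \<or> (\<exists>l g. vec.subspace l
        \<and> holomorphic_map_on (*s) (*) g (l \<inter> unit_ball)
        \<and> g ` (l \<inter> unit_ball) \<subseteq> unit_disc
        \<and> Z = {(g z, z) | z. z \<in> l \<inter> unit_ball})
   \<or> (\<exists>L. cprod.p.subspace L \<and> cprod.p.dim L \<ge> 2 \<and> Z = L \<inter> (unit_disc \<times> unit_ball))"
proof -
  obtain r P where r: "holomorphic_self_map r" "r 0 = 0" "(r has_derivative P) (at 0)"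
      and linP: "Vector_Spaces.linear cprod.scale cprod.scale P"
      and Z_P: "Z = r ` {x. P x = x \<and> mnorm x < 1}"
    by (rule retract_over_tangent_space[OF retract origin])
  interpret P: Vector_Spaces.linear cprod.scale cprod.scale P by fact
  define L where "L = {x. P x = x}"
  have L: "cprod.p.subspace L"
    unfolding L_def by (rule cprod.p.subspaceI) (simp_all add: P.zero P.add P.scale)
  have Z: "Z = {r x | x. x \<in> L \<and> mnorm x < 1}"
    unfolding Z_P L_def by blast
  note Schwarz_fst = Schwarz_self_map_fst[OF r linP] and Schwarz_snd = Schwarz_self_map_snd[OF r linP]
  show ?thesis
  proof (cases "\<forall>x\<in>L. norm (fst x) \<le> norm (snd x)")
    case True
    have "\<exists>l g. vec.subspace l \<and> holomorphic_map_on (*s) (*) g (l \<inter> unit_ball)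
        \<and> g ` (l \<inter> unit_ball) \<subseteq> unit_disc \<and> Z = {(g z, z) | z. z \<in> l \<inter> unit_ball}"
    proof -
      have inj: "inj_on snd L"
      proof (rule inj_onI)
        fix x y assume "x \<in> L" "y \<in> L" "snd x = snd y"
        moreover from this have "norm (fst (x - y)) \<le> norm (snd (x - y))"
          using True cprod.p.subspace_diff[OF L] by blast
        ultimately show "x = y"
          by (simp add: prod_eq_iff)
      qed
      have pair: "vector_space_pair cprod.scale ((*s) :: complex \<Rightarrow> complex ^ 'm \<Rightarrow> complex ^ 'm)"
        by unfold_locales
      obtain \<mu> where \<mu>: "Vector_Spaces.linear (*s) cprod.scale \<mu>" "\<And>x. x \<in> L \<Longrightarrow> \<mu> (snd x) = x"
        using vector_space_pair.linear_exists_left_inverse_on[OF pair cprod.linear_snd L inj] by blast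
      have lim: "snd x \<in> unit_ball \<Longrightarrow> mnorm x < 1" if "x \<in> L" for x
        using True that by (auto simp: mnorm_def)
      define g where "g = (\<lambda>z. fst (r (\<mu> z)))"
      interpret S: Vector_Spaces.linear cprod.scale "(*s)" snd
        by (rule cprod.linear_snd)
      have "holomorphic_map_on (*s) (*) g (snd ` L \<inter> unit_ball)"
        unfolding holomorphic_map_on_def
      proof
        fix z assume "z \<in> snd ` L \<inter> unit_ball"
        then have "mnorm (\<mu> z) < 1"
          using \<mu>(2) lim by auto
        then obtain r' where r': "Vector_Spaces.linear cprod.scale cprod.scale r'" "(r has_derivative r') (at (\<mu> z))"
          by (rule holomorphic_map_on_disc_times_ballD[OF holomorphic_self_mapD(1)[OF r(1)]])
        have "bounded_linear \<mu>"
          by (rule complex_linear_imp_bounded_linear[OF \<mu>(1) scale_of_real_vec scale_of_real_prod])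
        then have "(\<mu> has_derivative \<mu>) (at z within snd ` L \<inter> unit_ball)"
          by (rule bounded_linear_imp_has_derivative)
        then have "(g has_derivative (\<lambda>h. fst (r' (\<mu> h)))) (at z within snd ` L \<inter> unit_ball)"
          unfolding g_def by (intro has_derivative_fst has_derivative_compose[where f = \<mu> and g = r, OF _ r'(2)])
        moreover have "Vector_Spaces.linear (*s) (*) (\<lambda>h. fst (r' (\<mu> h)))"
          using Vector_Spaces.linear_compose[OF Vector_Spaces.linear_compose[OF \<mu>(1) r'(1)] cprod.linear_fst]
          by (simp add: comp_def)
        ultimately show "\<exists>f'. Vector_Spaces.linear (*s) (*) f' \<and>
            (g has_derivative f') (at z within snd ` L \<inter> unit_ball)"
          by blast
      qed
      moreover have r_g: "r x = (g (snd x), snd x)" "g (snd x) \<in> unit_disc" if "x \<in> L" "mnorm x < 1" for x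
      proof -
        have "snd (r x) = snd x"
          using that True by (intro Schwarz_snd) (auto simp: L_def)
        moreover have "g (snd x) = fst (r x)"
          by (simp add: g_def \<mu>(2)[OF that(1)])
        ultimately show "r x = (g (snd x), snd x)" "g (snd x) \<in> unit_disc"
          using holomorphic_self_mapD(2)[OF r(1) that(2)] by (simp_all add: prod_eq_iff mnorm_def)
      qed
      then have "g ` (snd ` L \<inter> unit_ball) \<subseteq> unit_disc"
        using lim by blast
      moreover have "Z = {(g z, z) | z. z \<in> snd ` L \<inter> unit_ball}"
      proof (intro set_eqI iffI)
        fix y assume "y \<in> Z"
        then obtain x where x: "x \<in> L" "mnorm x < 1" "y = r x"
          unfolding Z by blast
        then show "y \<in> {(g z, z) | z. z \<in> snd ` L \<inter> unit_ball}"
          using r_g(1)[of x] by (auto simp: mnorm_def)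
      next
        fix y assume "y \<in> {(g z, z) | z. z \<in> snd ` L \<inter> unit_ball}"
        then obtain x where "x \<in> L" "snd x \<in> unit_ball" "y = (g (snd x), snd x)"
          by blast
        then have "y = r x" "x \<in> L" "mnorm x < 1"
          using r_g(1)[of x] lim[of x] by simp_all
        then show "y \<in> Z"
          unfolding Z by blast
      qed
      ultimately show ?thesis
        using S.subspace_image[OF L] by (intro exI[of _ "snd ` L"] exI[of _ g] conjI)
    qed
    then show ?thesis
      by (rule disjI2[OF disjI2[OF disjI1]])
  next
    case False
    then obtain x0 where x0: "x0 \<in> L" "norm (snd x0) < norm (fst x0)"
      unfolding Ball_def not_all not_imp not_le by blast
    \<comment> \<open>The identity theorem needs a point inside the domain. A condition stable under
      positive scaling keeps its witness when that is shrunk; the factor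
      \<open>1 / (1 + mnorm x)\<close> is positive and always suffices.\<close>
    have rescaled: "\<exists>p. p \<in> L \<and> mnorm p < 1 \<and> Q p"
      if "x \<in> L" "Q x" and Q: "\<And>a x. a > 0 \<Longrightarrow> Q x \<Longrightarrow> Q (cprod.scale (complex_of_real a) x)" for x Q
    proof (intro exI conjI)
      let ?a = "inverse (1 + mnorm x)"
      show "cprod.scale (complex_of_real ?a) x \<in> L"
        using L that by (intro cprod.p.subspace_scale)
      show "mnorm (cprod.scale (complex_of_real ?a) x) < 1"
        using mnorm_nonneg[of x] unfolding mnorm_scale norm_of_real by (simp add: divide_simps)
      show "Q (cprod.scale (complex_of_real ?a) x)"
        by (rule Q[OF _ \<open>Q x\<close>]) (use mnorm_nonneg[of x] in simp)
    qed
    have holr: "holomorphic_map_on cprod.scale cprod.scale (\<lambda>x. r x - x) (unit_disc \<times> unit_ball)"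
      by (intro holomorphic_map_on_diff holomorphic_self_mapD(1) r holomorphic_self_map_id)
    have r_fst: "fst (r x) = fst x" if "x \<in> L" "mnorm x < 1" for x
    proof -
      let ?U = "{y :: complex \<times> (complex ^ 'm). norm (snd y) < norm (fst y)}"
      have "open ?U"
        by (intro open_Collect_less continuous_intros)
      obtain p where p: "p \<in> L" "mnorm p < 1" "p \<in> ?U"
        using rescaled[of x0 "\<lambda>p. p \<in> ?U"] x0 by (auto simp: cprod.scale_def norm_mult norm_scale_vec)
      \<comment> \<open>The equality case gives this on the open cone \<open>?U\<close>, which meets
        \<open>L\<close> near \<open>p\<close>; the identity theorem extends it to all of
        \<open>L\<close> in the domain.\<close>
      have "fst (r x - x) = 0"
        by (rule slice_identity_theorem[OF holr fst_dual_ball L \<open>open ?U\<close> p(1,3,2) _ that])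
           (use Schwarz_fst in \<open>auto simp: L_def\<close>)
      then show ?thesis by simp
    qed
    show ?thesis
    proof (cases "\<forall>x\<in>L. fst x = 0 \<longrightarrow> x = 0")
      case True
      \<comment> \<open>The generator of the line \<open>L\<close> with first coordinate
        \<open>1\<close>. Its second component is shorter than \<open>1\<close>, so
        \<open>cprod.scale w e\<close> lies in the domain exactly for \<open>w\<close> in the
        disc.\<close>
      define e where "e = cprod.scale (inverse (fst x0)) x0"
      have "fst x0 \<noteq> 0"
        using x0 by auto
      then have e: "fst e = 1" "norm (snd e) < 1"
        using x0 by (simp_all add: e_def cprod.scale_def norm_scale_vec norm_divide inverse_eq_divide)
      have "e \<in> L"
        unfolding e_def by (rule cprod.p.subspace_scale[OF L x0(1)])
      note e = e this
      have L_e: "x = cprod.scale (fst x) e" if "x \<in> L" for x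
      proof -
        have "x - cprod.scale (fst x) e \<in> L"
          using L that e by (intro cprod.p.subspace_diff cprod.p.subspace_scale)
        moreover have "fst (x - cprod.scale (fst x) e) = 0"
          by (simp add: cprod.scale_def e(1))
        ultimately have "x - cprod.scale (fst x) e = 0"
          using True by blast
        then show ?thesis by simp
      qed
      have mnorm_e: "mnorm (cprod.scale w e) = norm w" for w
        unfolding mnorm_scale using e by (simp add: mnorm_def max_def)
      define f where "f = (\<lambda>w. snd (r (cprod.scale w e)))"
      have hol_f: "holomorphic_map_on (*) (*s) f unit_disc"
        unfolding holomorphic_map_on_def
      proof
        fix w :: complex assume "w \<in> unit_disc"
        then have "mnorm (cprod.scale w e) < 1"
          by (simp add: mnorm_e)
        then obtain r' where r': "Vector_Spaces.linear cprod.scale cprod.scale r'"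
            "(r has_derivative r') (at (cprod.scale w e))"
          by (rule holomorphic_map_on_disc_times_ballD[OF holomorphic_self_mapD(1)[OF r(1)]])
        have "((\<lambda>w. cprod.scale w e) has_derivative (\<lambda>w. cprod.scale w e)) (at w within unit_disc)"
          by (rule bounded_linear_imp_has_derivative) (rule bounded_linear_cprod_scale_left)
        then have "(f has_derivative (\<lambda>h. snd (r' (cprod.scale h e)))) (at w within unit_disc)"
          unfolding f_def by (intro has_derivative_snd has_derivative_compose[where f = "\<lambda>w. cprod.scale w e" and g = r, OF _ r'(2)])
        moreover have "Vector_Spaces.linear (*) (*s) (\<lambda>h. snd (r' (cprod.scale h e)))"
          using Vector_Spaces.linear_compose[OF Vector_Spaces.linear_compose[OF linear_cprod_scale_left r'(1)] cprod.linear_snd]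
          by (simp add: comp_def)
        ultimately show "\<exists>f'. Vector_Spaces.linear (*) (*s) f' \<and> (f has_derivative f') (at w within unit_disc)"
          by blast
      qed
      have r_e: "r (cprod.scale w e) = (w, f w)" "f w \<in> unit_ball" if "w \<in> unit_disc" for w
      proof -
        have w: "mnorm (cprod.scale w e) < 1"
          using that by (simp add: mnorm_e)
        have "fst (r (cprod.scale w e)) = w"
          using r_fst[OF cprod.p.subspace_scale[OF L e(3)] w] by (simp add: cprod.scale_def e(1))
        then show "r (cprod.scale w e) = (w, f w)"
          by (simp add: prod_eq_iff f_def)
        show "f w \<in> unit_ball"
          using holomorphic_self_mapD(2)[OF r(1) w] by (simp add: f_def mnorm_def)
      qed
      have "Z = {(w, f w) | w. w \<in> unit_disc}"
      proof -
        have "{x. x \<in> L \<and> mnorm x < 1} = (\<lambda>w. cprod.scale w e) ` unit_disc"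
        proof (intro set_eqI iffI)
          fix x assume "x \<in> {x. x \<in> L \<and> mnorm x < 1}"
          then show "x \<in> (\<lambda>w. cprod.scale w e) ` unit_disc"
            using L_e[of x] mnorm_e[of "fst x"] by (intro image_eqI[of _ _ "fst x"]) auto
        qed (use mnorm_e cprod.p.subspace_scale[OF L e(3)] in auto)
        then have "Z = (\<lambda>w. r (cprod.scale w e)) ` unit_disc"
          unfolding Z_P L_def by (simp add: image_image)
        also have "\<dots> = (\<lambda>w. (w, f w)) ` unit_disc"
          using r_e(1) by (rule image_cong[OF refl])
        finally show ?thesis
          by blast
      qed
      moreover note hol_f
      moreover have "f ` unit_disc \<subseteq> unit_ball"
        using r_e(2) by blast
      ultimately show ?thesis
        by (intro disjI2[OF disjI1[OF exI[of _ f]]] conjI)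
    next
      case False
      then obtain x1 where x1: "x1 \<in> L" "fst x1 = 0" "x1 \<noteq> 0"
        by blast
      then have "snd x1 \<noteq> 0"
        by (auto simp: prod_eq_iff)
      have r_snd: "snd (r x) = snd x" if "x \<in> L" "mnorm x < 1" for x
      \<comment> \<open>The identity theorem is stated for scalar functionals, so each coordinate is
        treated separately, with the functional \<open>hprod (axis i 1)\<close>. The cone is now the
        opposite one, which contains \<open>x1\<close>.\<close>
      proof (unfold vec_eq_iff, rule allI)
        fix i :: 'm
        let ?U = "{y :: complex \<times> (complex ^ 'm). norm (fst y) < norm (snd y)}"
        have "open ?U"
          by (intro open_Collect_less continuous_intros)
        obtain p where p: "p \<in> L" "mnorm p < 1" "p \<in> ?U"
          using rescaled[of x1 "\<lambda>p. p \<in> ?U"] x1 \<open>snd x1 \<noteq> 0\<close>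
          by (auto simp: cprod.scale_def norm_mult norm_scale_vec)
        have axis: "hprod (axis i 1) v = v $ i" for v
          by (simp add: hprod_def axis_def if_distrib if_distribR cong: if_cong)
        have "(\<lambda>y. hprod (axis i 1) (snd y)) \<in> dual_ball"
          by (rule hprod_dual_ball) simp
        then have "hprod (axis i 1) (snd (r x - x)) = 0"
          by (rule slice_identity_theorem[OF holr _ L \<open>open ?U\<close> p(1,3,2) _ that])
             (use Schwarz_snd in \<open>simp add: axis L_def\<close>)
        then show "snd (r x) $ i = snd x $ i"
          by (simp add: axis)
      qed
      have "r x = x" if "x \<in> L" "mnorm x < 1" for x
        using r_fst[OF that] r_snd[OF that] by (rule prod_eqI)
      then have "Z = {x \<in> L. mnorm x < 1}"
        unfolding Z by (metis (lifting))
      then have "Z = L \<inter> (unit_disc \<times> unit_ball)"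
        unfolding mnorm_less_1_iff by blast
      moreover have "2 \<le> cprod.p.dim L"
      proof -
        \<comment> \<open>\<open>x0\<close> has a nonzero first coordinate, while every multiple of
          \<open>x1\<close> has first coordinate \<open>0\<close>.\<close>
        have "x0 \<notin> cprod.p.span {x1}"
          using x0 x1 by (auto simp: cprod.p.span_singleton cprod.scale_def)
        then have "cprod.p.independent {x0, x1}" "x0 \<noteq> x1"
          using x1 by (auto simp: cprod.p.independent_insert cprod.p.span_base)
        then show ?thesis
          using cprod.p.independent_card_le_dim[of "{x0, x1}" L] x0 x1 by simp
      qed
      ultimately show ?thesis
        using L by (intro disjI2[OF disjI2[OF disjI2[OF exI[of _ L]]]] conjI)
    qed
  qed
qed

end
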